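(* Let $f\colon P\to Q$ and $g\colon Q'\to Q$ be surjective quandle homomorphisms. Then the pullback $f'\colon P\times_Q Q'\to Q'$ of $f$ along $g$ is strongly connected if and only if $f$ is strongly connected.
   Context: A quandle is a set $Q$ with bijections $s_x\colon Q\to Q$ ($x\in Q$) such that $s_x(x)=x$ and $s_x\circ s_y=s_{s_x(y)}\circ s_x$ for all $x,y\in Q$. A quandle homomorphism $f\colon P\to Q$ is a map with $f(s_x(y))=s_{f(x)}(f(y))$ for all $x,y\in P$. For a surjective quandle homomorphism $f\colon P\to Q$, the relative transvection group is $\mathrm{Trans}_{\mathrm{rel}}(f)=\langle s_xs_y^{-1}\mid x,y\in P,\ f(x)=f(y)\rangle$, a group of permutations of $P$ preserving each fiber of $f$. The homomorphism $f$ is strongly connected if it is surjective and $\mathrm{Trans}_{\mathrm{rel}}(f)$ acts transitively on every fiber of $f$. The pullback $P\times_Q Q'=\{(x,q')\in P\times Q'\mid f(x)=g(q')\}$ carries the componentwise quandle structure, and $f'$ is the projection $(x,q')\mapsto q'$. *)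

theory Defs
  imports "HOL-Algebra.Algebra"
begin

text \<open>The field \<open>qsym Q x\<close> is the symmetry \<open>s\<^sub>x\<close> of \<open>Q\<close>; only its values at points
  of the carrier are meaningful.\<close>

record 'a quandle = "'a partial_object" +
  qsym :: "'a \<Rightarrow> 'a \<Rightarrow> 'a"

definition is_quandle :: "('a, 'm) quandle_scheme \<Rightarrow> bool" where
  "is_quandle Q \<longleftrightarrow>
     (\<forall>x\<in>carrier Q. bij_betw (qsym Q x) (carrier Q) (carrier Q)) \<and>
     (\<forall>x\<in>carrier Q. qsym Q x x = x) \<and>
     (\<forall>x\<in>carrier Q. \<forall>y\<in>carrier Q. \<forall>z\<in>carrier Q.
        qsym Q x (qsym Q y z) = qsym Q (qsym Q x y) (qsym Q x z))"

definition quandle_hom ::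
    "('a, 'm) quandle_scheme \<Rightarrow> ('b, 'n) quandle_scheme \<Rightarrow> ('a \<Rightarrow> 'b) set" where
  "quandle_hom P Q = {f \<in> carrier P \<rightarrow> carrier Q.
     \<forall>x\<in>carrier P. \<forall>y\<in>carrier P. f (qsym P x y) = qsym Q (f x) (f y)}"

text \<open>Elements of \<open>BijGroup S\<close> are functions that are \<^const>\<open>undefined\<close> outside \<open>S\<close>,
  which is why symmetries have to be restricted to the carrier.\<close>

definition qperm :: "('a, 'm) quandle_scheme \<Rightarrow> 'a \<Rightarrow> 'a \<Rightarrow> 'a" where
  "qperm Q x = restrict (qsym Q x) (carrier Q)"

definition trans_rel :: "('a, 'm) quandle_scheme \<Rightarrow> ('a \<Rightarrow> 'b) \<Rightarrow> ('a \<Rightarrow> 'a) set" where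
  "trans_rel P f = generate (BijGroup (carrier P))
     {qperm P x \<otimes>\<^bsub>BijGroup (carrier P)\<^esub> inv\<^bsub>BijGroup (carrier P)\<^esub> (qperm P y) | x y.
        x \<in> carrier P \<and> y \<in> carrier P \<and> f x = f y}"

definition fiber :: "('a, 'm) quandle_scheme \<Rightarrow> ('a \<Rightarrow> 'b) \<Rightarrow> 'b \<Rightarrow> 'a set" where
  "fiber P f q = {x \<in> carrier P. f x = q}"

definition strongly_connected ::
    "('a, 'm) quandle_scheme \<Rightarrow> ('b, 'n) quandle_scheme \<Rightarrow> ('a \<Rightarrow> 'b) \<Rightarrow> bool" where
  "strongly_connected P Q f \<longleftrightarrow>
     f \<in> quandle_hom P Q \<and> f ` carrier P = carrier Q \<and>
     (\<forall>q\<in>carrier Q. \<forall>x\<in>fiber P f q. \<forall>y\<in>fiber P f q. \<exists>\<phi>\<in>trans_rel P f. \<phi> x = y)"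

definition pullback ::
    "('a, 'm) quandle_scheme \<Rightarrow> ('b, 'n) quandle_scheme \<Rightarrow> ('a \<Rightarrow> 'c) \<Rightarrow> ('b \<Rightarrow> 'c) \<Rightarrow> ('a \<times> 'b) quandle" where
  "pullback P Q' f g =
     \<lparr>carrier = {(x, q'). x \<in> carrier P \<and> q' \<in> carrier Q' \<and> f x = g q'},
      qsym = (\<lambda>(x, q') (y, r'). (qsym P x y, qsym Q' q' r'))\<rparr>"

end

(* A relative transvection of f' is built from pairs (x, q'), (y, q') with equal second
   component, so the second-component symmetries cancel and it acts as
   (z, r) |-> (s_x s_y^-1 z, r).  As g is surjective, every generator of Trans_rel(f) arises
   in this way; hence the two relative transvection groups act on the fibers, which are
   identified by the first projection, through the same permutations. *)
theory Submission
  imports Defs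
begin

section \<open>Relations between generated subgroups\<close>

text \<open>A relation compatible with unit, product and inverse cuts out a subgroup of the product
  of \<open>G\<close> and \<open>H\<close>, so a match between generators propagates to the
  generated subgroups by induction. A relation is used instead of a homomorphism so that the same
  argument also applies to its converse.\<close>

lemma generate_related:
  assumes "group G" and "group H" and "A \<subseteq> carrier G" and "B \<subseteq> carrier H"
    and generators: "\<And>a. a \<in> A \<Longrightarrow> \<exists>b\<in>B. R a b"
    and one: "R \<one>\<^bsub>G\<^esub> \<one>\<^bsub>H\<^esub>"
    and mult: "\<And>a a' b b'. \<lbrakk>a \<in> carrier G; a' \<in> carrier G; b \<in> carrier H; b' \<in> carrier H;
      R a b; R a' b'\<rbrakk> \<Longrightarrow> R (a \<otimes>\<^bsub>G\<^esub> a') (b \<otimes>\<^bsub>H\<^esub> b')"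
    and inv: "\<And>a b. \<lbrakk>a \<in> carrier G; b \<in> carrier H; R a b\<rbrakk> \<Longrightarrow> R (inv\<^bsub>G\<^esub> a) (inv\<^bsub>H\<^esub> b)"
    and "a \<in> generate G A"
  shows "\<exists>b\<in>generate H B. R a b"
  using \<open>a \<in> generate G A\<close>
proof (induction rule: generate.induct)
  case one
  then show ?case using \<open>R \<one>\<^bsub>G\<^esub> \<one>\<^bsub>H\<^esub>\<close> generate.one by blast
next
  case (incl a)
  then show ?case using generators generate.incl by metis
next
  case (inv a)
  then obtain b where "b \<in> B" "R a b" using generators by blast
  then show ?case
    using inv assms(3,4) \<open>\<And>a b. \<lbrakk>a \<in> carrier G; b \<in> carrier H; R a b\<rbrakk> \<Longrightarrow> R (inv\<^bsub>G\<^esub> a) (inv\<^bsub>H\<^esub> b)\<close>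
      generate.inv[of b B H] by (meson subsetD)
next
  case (eng a a')
  then obtain b b' where b: "b \<in> generate H B" "R a b" "b' \<in> generate H B" "R a' b'" by blast
  moreover have "a \<in> carrier G" "a' \<in> carrier G" "b \<in> carrier H" "b' \<in> carrier H"
    using eng b assms(1-4) by (auto intro: group.generate_in_carrier)
  ultimately show ?case using mult generate.eng by metis
qed

section \<open>Permutations acting on the first component only\<close>

text \<open>This says that \<psi> agrees on \<open>S\<close> with the product map \<phi> \<times>
  id. Only points of \<open>S\<close> are constrained, because members of \<open>Bij S\<close> carry
  no information elsewhere.\<close>

definition lifts :: "('a \<times> 'c) set \<Rightarrow> ('a \<Rightarrow> 'a) \<Rightarrow> ('a \<times> 'c \<Rightarrow> 'a \<times> 'c) \<Rightarrow> bool" where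
  "lifts S \<phi> \<psi> \<longleftrightarrow> (\<forall>z r. (z, r) \<in> S \<longrightarrow> \<psi> (z, r) = (\<phi> z, r))"

lemma BijGroup_mult_apply:
  assumes "\<phi> \<in> Bij S" and "\<psi> \<in> Bij S" and "x \<in> S"
  shows "(\<phi> \<otimes>\<^bsub>BijGroup S\<^esub> \<psi>) x = \<phi> (\<psi> x)"
  using assms by (simp add: BijGroup_def compose_def)

lemma BijGroup_inv_apply:
  assumes "\<phi> \<in> Bij S" and "x \<in> S"
  shows "(inv\<^bsub>BijGroup S\<^esub> \<phi>) (\<phi> x) = x"
  using assms Bij_imp_funcset[of \<phi> S]
  by (auto simp: inv_BijGroup Bij_def bij_betw_def inv_into_f_f)

lemma carrier_BijGroup: "carrier (BijGroup S) = Bij S"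
  by (simp add: BijGroup_def)

lemma lifts_one:
  assumes "fst ` S \<subseteq> A"
  shows "lifts S \<one>\<^bsub>BijGroup A\<^esub> \<one>\<^bsub>BijGroup S\<^esub>"
  using assms by (force simp: lifts_def BijGroup_def)

lemma lifts_mult:
  assumes "fst ` S \<subseteq> A" and "\<phi> \<in> Bij A" "\<phi>' \<in> Bij A" and "\<psi> \<in> Bij S" "\<psi>' \<in> Bij S"
    and "lifts S \<phi> \<psi>" and "lifts S \<phi>' \<psi>'"
  shows "lifts S (\<phi> \<otimes>\<^bsub>BijGroup A\<^esub> \<phi>') (\<psi> \<otimes>\<^bsub>BijGroup S\<^esub> \<psi>')"
  unfolding lifts_def
proof (intro allI impI)
  fix z r assume S: "(z, r) \<in> S"
  then have "z \<in> A" using assms(1) by force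
  moreover have "\<psi>' (z, r) = (\<phi>' z, r)" using S assms by (simp add: lifts_def)
  \<comment> \<open>\<psi>' stays inside \<open>S\<close>, so the lifting property of \<psi> applies
    at the intermediate point.\<close>
  moreover have "\<psi>' (z, r) \<in> S" using S assms Bij_imp_funcset by blast
  ultimately show "(\<psi> \<otimes>\<^bsub>BijGroup S\<^esub> \<psi>') (z, r) = ((\<phi> \<otimes>\<^bsub>BijGroup A\<^esub> \<phi>') z, r)"
    using S assms by (simp add: lifts_def BijGroup_mult_apply)
qed

lemma lifts_inv:
  assumes "fst ` S \<subseteq> A" and "\<phi> \<in> Bij A" and "\<psi> \<in> Bij S" and "lifts S \<phi> \<psi>"
  shows "lifts S (inv\<^bsub>BijGroup A\<^esub> \<phi>) (inv\<^bsub>BijGroup S\<^esub> \<psi>)"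
  unfolding lifts_def
proof (intro allI impI)
  fix z r assume "(z, r) \<in> S"
  \<comment> \<open>Every point of \<open>S\<close> is an image under \<psi>. Writing it as
    \<open>\<psi> w\<close> lets both inverses be evaluated by cancellation, with \<phi> acting on
    \<open>fst w\<close>.\<close>
  then obtain w where w: "w \<in> S" "(z, r) = \<psi> w"
    using \<open>\<psi> \<in> Bij S\<close> by (metis Bij_def IntD2 bij_betw_imp_surj_on imageE mem_Collect_eq)
  then have "z = \<phi> (fst w)" "r = snd w" using assms(4) by (cases w; simp add: lifts_def)+
  moreover have "fst w \<in> A" using w assms(1) by force
  ultimately show "(inv\<^bsub>BijGroup S\<^esub> \<psi>) (z, r) = ((inv\<^bsub>BijGroup A\<^esub> \<phi>) z, r)"
    using w assms by (simp add: BijGroup_inv_apply)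
qed

section \<open>Symmetries and transvections of a quandle\<close>

lemma qsym_bij:
  assumes "is_quandle P" and "x \<in> carrier P"
  shows "bij_betw (qsym P x) (carrier P) (carrier P)"
  using assms by (simp add: is_quandle_def)

lemma qsym_closed:
  assumes "is_quandle P" and "x \<in> carrier P" and "y \<in> carrier P"
  shows "qsym P x y \<in> carrier P"
  using qsym_bij[OF assms(1,2)] assms(3) by (rule bij_betw_apply)

lemma qperm_Bij:
  assumes "is_quandle P" and "x \<in> carrier P"
  shows "qperm P x \<in> Bij (carrier P)"
  using qsym_bij[OF assms] by (simp add: qperm_def Bij_def)

lemma transvection_in_carrier:
  assumes "is_quandle P" and "x \<in> carrier P" and "y \<in> carrier P"
  shows "qperm P x \<otimes>\<^bsub>BijGroup (carrier P)\<^esub> inv\<^bsub>BijGroup (carrier P)\<^esub> (qperm P y)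
    \<in> carrier (BijGroup (carrier P))"
proof -
  interpret group "BijGroup (carrier P)" by (rule group_BijGroup)
  show ?thesis using assms qperm_Bij[of P]
    by (intro m_closed inv_closed) (auto simp: carrier_BijGroup)
qed

text \<open>Evaluating at a point of the form s_y(z) makes s_y^{-1} cancel. Since s_y is surjective,
  this describes the transvection everywhere without an explicit formula for the inverse.\<close>

lemma transvection_apply:
  assumes "is_quandle P" and "x \<in> carrier P" and "y \<in> carrier P" and "z \<in> carrier P"
  shows "(qperm P x \<otimes>\<^bsub>BijGroup (carrier P)\<^esub> inv\<^bsub>BijGroup (carrier P)\<^esub> (qperm P y)) (qsym P y z)
    = qsym P x z"
proof -
  have "qsym P y z \<in> carrier P"
    using assms by (simp add: qsym_closed)
  moreover have "inv\<^bsub>BijGroup (carrier P)\<^esub> (qperm P y) \<in> Bij (carrier P)"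
    using group.inv_closed[OF group_BijGroup] qperm_Bij[OF assms(1,3)]
    by (simp add: carrier_BijGroup[symmetric])
  moreover have "(inv\<^bsub>BijGroup (carrier P)\<^esub> (qperm P y)) (qsym P y z) = z"
    using BijGroup_inv_apply[OF qperm_Bij[OF assms(1,3)] assms(4)] assms(4)
    by (simp add: qperm_def)
  ultimately show ?thesis
    using BijGroup_mult_apply[OF qperm_Bij[OF assms(1,2)]] assms(4) by (simp add: qperm_def)
qed

section \<open>The pullback quandle\<close>

text \<open>The identities hold componentwise, and closure follows from \<open>f\<close> and
  \<open>g\<close> being homomorphisms. The delicate point is surjectivity of a symmetry: preimages
  found separately in \<open>P\<close> and \<open>Q'\<close> must lie over the same point of
  \<open>Q\<close>, which follows from injectivity of the symmetries of \<open>Q\<close>.\<close>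

lemma is_quandle_pullback:
  assumes P: "is_quandle P" and Q: "is_quandle Q" and Q': "is_quandle Q'"
    and f: "f \<in> quandle_hom P Q" and g: "g \<in> quandle_hom Q' Q"
  shows "is_quandle (pullback P Q' f g)"
proof -
  let ?R = "pullback P Q' f g"
  have closed: "qsym ?R a b \<in> carrier ?R" if "a \<in> carrier ?R" "b \<in> carrier ?R" for a b
    using that f g
    by (auto simp: pullback_def quandle_hom_def qsym_closed[OF P] qsym_closed[OF Q'])
  have "bij_betw (qsym ?R a) (carrier ?R) (carrier ?R)" if a: "a \<in> carrier ?R" for a
  proof -
    obtain x q' where xq: "a = (x, q')" "x \<in> carrier P" "q' \<in> carrier Q'" "f x = g q'"
      using a by (auto simp: pullback_def)
    have bij: "bij_betw (qsym P x) (carrier P) (carrier P)"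
      "bij_betw (qsym Q' q') (carrier Q') (carrier Q')"
      "bij_betw (qsym Q (f x)) (carrier Q) (carrier Q)"
      using qsym_bij[OF P xq(2)] qsym_bij[OF Q' xq(3)] qsym_bij[OF Q, of "f x"] f xq(2)
      by (auto simp: quandle_hom_def)
    have "inj_on (qsym ?R a) (carrier ?R)"
    proof (rule inj_onI)
      fix b c assume "b \<in> carrier ?R" "c \<in> carrier ?R" "qsym ?R a b = qsym ?R a c"
      then show "b = c"
        using inj_onD[OF bij_betw_imp_inj_on[OF bij(1)]] inj_onD[OF bij_betw_imp_inj_on[OF bij(2)]]
        unfolding xq(1) by (auto simp: pullback_def)
    qed
    moreover have "b \<in> qsym ?R a ` carrier ?R" if b: "b \<in> carrier ?R" for b
    proof -
      obtain y r' where yr: "b = (y, r')" "y \<in> carrier P" "r' \<in> carrier Q'" "f y = g r'"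
        using b by (auto simp: pullback_def)
      obtain u v where uv: "u \<in> carrier P" "y = qsym P x u" "v \<in> carrier Q'" "r' = qsym Q' q' v"
        using bij_betw_imp_surj_on[OF bij(1)] bij_betw_imp_surj_on[OF bij(2)] yr(2,3) by blast
      \<comment> \<open>Both sides are the common image \<open>f y = g r'\<close> of
        \<open>b\<close> in \<open>Q\<close>; on the right, \<open>f x = g q'\<close> is
        used.\<close>
      have "qsym Q (f x) (f u) = qsym Q (f x) (g v)"
      proof -
        have "qsym Q (f x) (f u) = f y" using f xq(2) uv(1,2) by (simp add: quandle_hom_def)
        also have "\<dots> = qsym Q (f x) (g v)"
          using g xq(3,4) uv(3,4) yr(4) by (simp add: quandle_hom_def)
        finally show ?thesis .
      qed
      moreover have "f u \<in> carrier Q" "g v \<in> carrier Q"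
        using uv f g by (auto simp: quandle_hom_def)
      \<comment> \<open>Cancelling the symmetry at \<open>f x\<close> shows that
        \<open>(u, v)\<close> lies in the pullback.\<close>
      ultimately have "f u = g v" using bij_betw_imp_inj_on[OF bij(3)] by (metis inj_onD)
      then have "(u, v) \<in> carrier ?R" "b = qsym ?R a (u, v)"
        using uv yr(1) xq(1) by (simp_all add: pullback_def)
      then show ?thesis by blast
    qed
    ultimately show ?thesis
      using closed[OF a] unfolding bij_betw_def by blast
  qed
  moreover have "qsym ?R a a = a" if "a \<in> carrier ?R" for a
    using that P Q' by (cases a) (simp add: is_quandle_def pullback_def)
  moreover have "qsym ?R a (qsym ?R b c) = qsym ?R (qsym ?R a b) (qsym ?R a c)"
    if "a \<in> carrier ?R" "b \<in> carrier ?R" "c \<in> carrier ?R" for a b c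
  proof -
    have P_dist: "qsym P x (qsym P y z) = qsym P (qsym P x y) (qsym P x z)"
      if "x \<in> carrier P" "y \<in> carrier P" "z \<in> carrier P" for x y z
      using P that unfolding is_quandle_def by blast
    have Q'_dist: "qsym Q' x (qsym Q' y z) = qsym Q' (qsym Q' x y) (qsym Q' x z)"
      if "x \<in> carrier Q'" "y \<in> carrier Q'" "z \<in> carrier Q'" for x y z
      using Q' that unfolding is_quandle_def by blast
    obtain x x' y y' z z' where abc: "a = (x, x')" "b = (y, y')" "c = (z, z')"
      by (metis surj_pair)
    then show ?thesis
      using that P_dist[of x y z] Q'_dist[of x' y' z'] by (simp add: pullback_def)
  qed
  ultimately show ?thesis unfolding is_quandle_def by blast
qed

section \<open>Comparison of the relative transvection groups\<close>

text \<open>This is the base case for generators: two points with the same \<open>snd\<close> share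
  the component \<open>q'\<close>, so the second factor is s_{q'} composed with its own
  inverse.\<close>

lemma transvection_lifts:
  assumes P: "is_quandle P" and R: "is_quandle (pullback P Q' f g)"
    and x: "(x, q') \<in> carrier (pullback P Q' f g)" and y: "(y, q') \<in> carrier (pullback P Q' f g)"
  shows "lifts (carrier (pullback P Q' f g))
    (qperm P x \<otimes>\<^bsub>BijGroup (carrier P)\<^esub> inv\<^bsub>BijGroup (carrier P)\<^esub> (qperm P y))
    (qperm (pullback P Q' f g) (x, q') \<otimes>\<^bsub>BijGroup (carrier (pullback P Q' f g))\<^esub>
      inv\<^bsub>BijGroup (carrier (pullback P Q' f g))\<^esub> (qperm (pullback P Q' f g) (y, q')))"
  unfolding lifts_def
proof (intro allI impI)
  let ?R = "pullback P Q' f g"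
  fix z r assume "(z, r) \<in> carrier ?R"
  \<comment> \<open>The point is written as the symmetry at \<open>(y, q')\<close> applied to some
    \<open>w\<close>, the form in which \<open>transvection_apply\<close> evaluates both the upper
    and the lower transvection.\<close>
  then obtain w where w: "w \<in> carrier ?R" "(z, r) = qsym ?R (y, q') w"
    using qsym_bij[OF R y] by (metis bij_betw_imp_surj_on imageE)
  obtain u v where uv: "w = (u, v)" by (cases w)
  have "z = qsym P y u" "r = qsym Q' q' v" using w uv by (auto simp: pullback_def)
  moreover have "x \<in> carrier P" "y \<in> carrier P" "u \<in> carrier P"
    using x y w uv by (auto simp: pullback_def)
  moreover have "qsym ?R (x, q') w = (qsym P x u, qsym Q' q' v)"
    using uv by (simp add: pullback_def)
  ultimately show "(qperm ?R (x, q') \<otimes>\<^bsub>BijGroup (carrier ?R)\<^esub>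
      inv\<^bsub>BijGroup (carrier ?R)\<^esub> (qperm ?R (y, q'))) (z, r) =
    ((qperm P x \<otimes>\<^bsub>BijGroup (carrier P)\<^esub> inv\<^bsub>BijGroup (carrier P)\<^esub> (qperm P y)) z, r)"
    using transvection_apply[OF R x y w(1)] w(2) transvection_apply[OF P, of x y u] by simp
qed

text \<open>Both claims are instances of \<open>generate_related\<close>, once for
  \<open>lifts\<close> and once for its converse. The inclusion of images ensures that each point of
  \<open>P\<close> has a partner in \<open>Q'\<close>.\<close>

lemma trans_rel_pullback:
  assumes P: "is_quandle P" and R: "is_quandle (pullback P Q' f g)"
    and f: "f ` carrier P \<subseteq> g ` carrier Q'"
  shows trans_rel_lift: "\<phi> \<in> trans_rel P f \<Longrightarrow>
      \<exists>\<psi>\<in>trans_rel (pullback P Q' f g) snd. lifts (carrier (pullback P Q' f g)) \<phi> \<psi>"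
    and trans_rel_descend: "\<psi> \<in> trans_rel (pullback P Q' f g) snd \<Longrightarrow>
      \<exists>\<phi>\<in>trans_rel P f. lifts (carrier (pullback P Q' f g)) \<phi> \<psi>"
proof -
  let ?R = "pullback P Q' f g"
  let ?G = "BijGroup (carrier P)" and ?H = "BijGroup (carrier ?R)"
  let ?A = "{qperm P x \<otimes>\<^bsub>?G\<^esub> inv\<^bsub>?G\<^esub> (qperm P y) | x y.
    x \<in> carrier P \<and> y \<in> carrier P \<and> f x = f y}"
  let ?B = "{qperm ?R x \<otimes>\<^bsub>?H\<^esub> inv\<^bsub>?H\<^esub> (qperm ?R y) | x y.
    x \<in> carrier ?R \<and> y \<in> carrier ?R \<and> snd x = snd y}"
  have sub: "fst ` carrier ?R \<subseteq> carrier P" by (auto simp: pullback_def)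
  have A: "?A \<subseteq> carrier ?G" using transvection_in_carrier[OF P] by blast
  have B: "?B \<subseteq> carrier ?H" using transvection_in_carrier[OF R] by blast
  have up: "\<exists>b\<in>?B. lifts (carrier ?R) a b" if a: "a \<in> ?A" for a
  proof -
    obtain x y where xy: "a = qperm P x \<otimes>\<^bsub>?G\<^esub> inv\<^bsub>?G\<^esub> (qperm P y)"
      "x \<in> carrier P" "y \<in> carrier P" "f x = f y"
      using a by blast
    \<comment> \<open>As \<open>f x = f y\<close>, a single \<open>q'\<close> over
      \<open>f x\<close> completes both \<open>x\<close> and \<open>y\<close> to points of the
      pullback.\<close>
    obtain q' where "q' \<in> carrier Q'" "f x = g q'" using f xy(2) by blast
    then have mem: "(x, q') \<in> carrier ?R" "(y, q') \<in> carrier ?R"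
      using xy by (auto simp: pullback_def)
    show ?thesis
    proof (rule bexI)
      show "lifts (carrier ?R) a (qperm ?R (x, q') \<otimes>\<^bsub>?H\<^esub> inv\<^bsub>?H\<^esub> (qperm ?R (y, q')))"
        unfolding xy(1) by (rule transvection_lifts[OF P R mem])
      show "qperm ?R (x, q') \<otimes>\<^bsub>?H\<^esub> inv\<^bsub>?H\<^esub> (qperm ?R (y, q')) \<in> ?B"
        unfolding mem_Collect_eq
        by (rule exI[of _ "(x, q')"], rule exI[of _ "(y, q')"]) (simp add: mem)
    qed
  qed
  have down: "\<exists>a\<in>?A. lifts (carrier ?R) a b" if b: "b \<in> ?B" for b
  proof -
    obtain a c where ac: "b = qperm ?R a \<otimes>\<^bsub>?H\<^esub> inv\<^bsub>?H\<^esub> (qperm ?R c)"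
      "a \<in> carrier ?R" "c \<in> carrier ?R" "snd a = snd c"
      using b by blast
    then obtain x y q' where xy: "b = qperm ?R (x, q') \<otimes>\<^bsub>?H\<^esub> inv\<^bsub>?H\<^esub> (qperm ?R (y, q'))"
      and mem: "(x, q') \<in> carrier ?R" "(y, q') \<in> carrier ?R"
      by (metis prod.collapse)
    show ?thesis
    proof (rule bexI)
      show "lifts (carrier ?R) (qperm P x \<otimes>\<^bsub>?G\<^esub> inv\<^bsub>?G\<^esub> (qperm P y)) b"
        unfolding xy(1) by (rule transvection_lifts[OF P R mem])
      \<comment> \<open>Both \<open>f x\<close> and \<open>f y\<close> equal \<open>g q'\<close>, so
        the pair gives a generator downstairs.\<close>
      have "x \<in> carrier P" "y \<in> carrier P" "f x = f y" using mem by (auto simp: pullback_def)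
      then show "qperm P x \<otimes>\<^bsub>?G\<^esub> inv\<^bsub>?G\<^esub> (qperm P y) \<in> ?A" by blast
    qed
  qed
  show "\<exists>\<psi>\<in>trans_rel ?R snd. lifts (carrier ?R) \<phi> \<psi>" if "\<phi> \<in> trans_rel P f"
    unfolding trans_rel_def
    by (rule generate_related[where R = "lifts (carrier ?R)",
          OF group_BijGroup group_BijGroup A B up lifts_one[OF sub]
          lifts_mult[OF sub, folded carrier_BijGroup] lifts_inv[OF sub, folded carrier_BijGroup]
          that[unfolded trans_rel_def]])
  show "\<exists>\<phi>\<in>trans_rel P f. lifts (carrier ?R) \<phi> \<psi>" if "\<psi> \<in> trans_rel ?R snd"
    unfolding trans_rel_def
  \<comment> \<open>The relation is reversed here: the upper group takes the first place, so the
    closure facts are applied with swapped arguments.\<close>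
  proof (rule generate_related[where R = "\<lambda>b a. lifts (carrier ?R) a b",
        OF group_BijGroup group_BijGroup B A down lifts_one[OF sub] _ _
        that[unfolded trans_rel_def]])
    fix \<psi> \<psi>' \<phi> \<phi>'
    assume "\<psi> \<in> carrier ?H" "\<psi>' \<in> carrier ?H" "\<phi> \<in> carrier ?G" "\<phi>' \<in> carrier ?G"
      "lifts (carrier ?R) \<phi> \<psi>" "lifts (carrier ?R) \<phi>' \<psi>'"
    then show "lifts (carrier ?R) (\<phi> \<otimes>\<^bsub>?G\<^esub> \<phi>') (\<psi> \<otimes>\<^bsub>?H\<^esub> \<psi>')"
      unfolding carrier_BijGroup by (intro lifts_mult[OF sub])
  next
    fix \<psi> \<phi>
    assume "\<psi> \<in> carrier ?H" "\<phi> \<in> carrier ?G" "lifts (carrier ?R) \<phi> \<psi>"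
    then show "lifts (carrier ?R) (inv\<^bsub>?G\<^esub> \<phi>) (inv\<^bsub>?H\<^esub> \<psi>)"
      unfolding carrier_BijGroup by (intro lifts_inv[OF sub])
  qed
qed

section \<open>Transitivity on fibers\<close>

theorem proposition3p32:
  fixes P :: "'a quandle" and Q :: "'b quandle" and Q' :: "'c quandle"
    and f :: "'a \<Rightarrow> 'b" and g :: "'c \<Rightarrow> 'b"
  assumes "is_quandle P" and "is_quandle Q" and "is_quandle Q'"
    and "f \<in> quandle_hom P Q" and "f ` carrier P = carrier Q"
    and "g \<in> quandle_hom Q' Q" and "g ` carrier Q' = carrier Q"
  shows "strongly_connected (pullback P Q' f g) Q' snd \<longleftrightarrow> strongly_connected P Q f"
proof -
  let ?R = "pullback P Q' f g"
  have R: "is_quandle ?R" using is_quandle_pullback assms by blast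
  have img: "f ` carrier P \<subseteq> g ` carrier Q'" using assms by simp
  have "snd \<in> quandle_hom ?R Q'" by (auto simp: quandle_hom_def pullback_def)
  moreover have "snd ` carrier ?R = carrier Q'"
  proof
    show "carrier Q' \<subseteq> snd ` carrier ?R"
    proof
      fix q' assume q': "q' \<in> carrier Q'"
      \<comment> \<open>Surjectivity of \<open>f\<close> supplies a point over
        \<open>g q'\<close>.\<close>
      then obtain x where "x \<in> carrier P" "g q' = f x" using assms(5,7) by blast
      then have "(x, q') \<in> carrier ?R" using q' by (simp add: pullback_def)
      then show "q' \<in> snd ` carrier ?R" by force
    qed
  qed (auto simp: pullback_def)
  \<comment> \<open>With the homomorphism property and surjectivity settled for both maps, only
    transitivity on fibers has to be compared.\<close>
  moreover have "(\<forall>q'\<in>carrier Q'. \<forall>a\<in>fiber ?R snd q'. \<forall>b\<in>fiber ?R snd q'.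
        \<exists>\<psi>\<in>trans_rel ?R snd. \<psi> a = b) \<longleftrightarrow>
      (\<forall>q\<in>carrier Q. \<forall>x\<in>fiber P f q. \<forall>y\<in>fiber P f q. \<exists>\<phi>\<in>trans_rel P f. \<phi> x = y)"
    (is "?up \<longleftrightarrow> ?down")
  proof
    assume up: ?up
    show ?down
    proof (intro ballI)
      fix q x y assume q: "q \<in> carrier Q" and xy: "x \<in> fiber P f q" "y \<in> fiber P f q"
      \<comment> \<open>Surjectivity of \<open>g\<close> gives \<open>q'\<close> over
        \<open>q\<close>; pairing with \<open>q'\<close> embeds the fiber of \<open>f\<close> over
        \<open>q\<close> into the pullback.\<close>
      obtain q' where q': "q' \<in> carrier Q'" "q = g q'" using q assms(7) by blast
      then have fib: "(x, q') \<in> fiber ?R snd q'" "(y, q') \<in> fiber ?R snd q'"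
        using xy by (auto simp: fiber_def pullback_def)
      then obtain \<psi> where \<psi>: "\<psi> \<in> trans_rel ?R snd" "\<psi> (x, q') = (y, q')"
        using up q'(1) by blast
      obtain \<phi> where \<phi>: "\<phi> \<in> trans_rel P f" "lifts (carrier ?R) \<phi> \<psi>"
        using trans_rel_descend[OF assms(1) R img \<psi>(1)] by blast
      \<comment> \<open>At \<open>(x, q')\<close> the lifting relation reads
        \<open>(y, q') = (\<phi> x, q')\<close>.\<close>
      then have "\<phi> x = y" using \<psi>(2) fib by (simp add: lifts_def fiber_def)
      then show "\<exists>\<phi>\<in>trans_rel P f. \<phi> x = y" using \<phi>(1) by blast
    qed
  next
    assume down: ?down
    show ?up
    proof (intro ballI)
      fix q' a b assume q': "q' \<in> carrier Q'" and ab: "a \<in> fiber ?R snd q'" "b \<in> fiber ?R snd q'"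
      obtain x y where xy: "a = (x, q')" "b = (y, q')" using ab by (cases a; cases b; simp add: fiber_def)
      \<comment> \<open>The first projection sends the fiber of \<open>snd\<close> over
        \<open>q'\<close> into the fiber of \<open>f\<close> over \<open>g q'\<close>, where
        transitivity is known.\<close>
      have "g q' \<in> carrier Q" "x \<in> fiber P f (g q')" "y \<in> fiber P f (g q')"
        using q' assms(7) ab xy by (auto simp: fiber_def pullback_def)
      then obtain \<phi> where \<phi>: "\<phi> \<in> trans_rel P f" "\<phi> x = y" using down by blast
      obtain \<psi> where \<psi>: "\<psi> \<in> trans_rel ?R snd" "lifts (carrier ?R) \<phi> \<psi>"
        using trans_rel_lift[OF assms(1) R img \<phi>(1)] by blast
      then have "\<psi> a = b" using \<phi>(2) ab xy by (simp add: lifts_def fiber_def)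
      then show "\<exists>\<psi>\<in>trans_rel ?R snd. \<psi> a = b" using \<psi>(1) by blast
    qed
  qed
  ultimately show ?thesis using assms(4,5) by (simp add: strongly_connected_def)
qed

end
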